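(* For all integers $q\ge1$ and $n\ge 1$, $$N_q(n,1)=q^{n-1}.$$
   Context: $N_q(n,s)$ denotes the maximum number of sequences in a set of $q$-ary sequences of length $n$ (elements of $\{0,1,\dots,q-1\}^n$) such that any two sequences in the set have the same entries in at least $s$ positions. *)

theory Defs
  imports Main
begin

definition seqs :: "nat \<Rightarrow> nat \<Rightarrow> nat list set" where
  "seqs q n = {x. length x = n \<and> set x \<subseteq> {0..<q}}"

definition agreement :: "nat list \<Rightarrow> nat list \<Rightarrow> nat set" where
  "agreement x y = {i. i < length x \<and> i < length y \<and> x ! i = y ! i}"

definition s_agreeing :: "nat \<Rightarrow> nat list set \<Rightarrow> bool" where
  "s_agreeing s A \<longleftrightarrow> (\<forall>x\<in>A. \<forall>y\<in>A. x \<noteq> y \<longrightarrow> s \<le> card (agreement x y))"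

definition N :: "nat \<Rightarrow> nat \<Rightarrow> nat \<Rightarrow> nat" where
  "N q n s = Max {card A | A. A \<subseteq> seqs q n \<and> s_agreeing s A}"

lemma finite_seqs: "finite (seqs q n)"
proof -
  have "seqs q n = {x. set x \<subseteq> {0..<q} \<and> length x = n}"
    by (auto simp: seqs_def)
  then show ?thesis
    by (simp add: finite_lists_length_eq)
qed

text \<open>The maximum is taken over a finite nonempty set, so it is attained.\<close>

lemma finite_N_candidates: "finite {card A | A. A \<subseteq> seqs q n \<and> s_agreeing s A}"
  by (rule finite_subset[of _ "card ` Pow (seqs q n)"]) (auto simp: finite_seqs)

lemma N_candidates_nonempty: "{card A | A. A \<subseteq> seqs q n \<and> s_agreeing s A} \<noteq> {}"
  by (auto simp: s_agreeing_def)

end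

theory Submission
  imports Defs
begin

text \<open>
  Call two sequences equivalent if they differ by adding a constant vector modulo \<open>q\<close>. Two distinct
  equivalent sequences disagree everywhere, so a 1-agreeing set meets each of the \<open>q ^ (n - 1)\<close>
  classes at most once. The sequences starting with 0 attain the bound.
\<close>

lemma card_seqs: "card (seqs q n) = q ^ n"
proof -
  have "seqs q n = {x. set x \<subseteq> {0..<q} \<and> length x = n}"
    by (auto simp: seqs_def)
  then show ?thesis
    by (simp add: card_lists_length_eq)
qed

text \<open>A complete invariant of the translation class of a nonempty sequence.\<close>

definition tail_differences :: "nat \<Rightarrow> nat list \<Rightarrow> int list" where
  "tail_differences q x = map (\<lambda>a. (int a - int (hd x)) mod int q) (tl x)"

text \<open>The only multiple of \<open>m\<close> with absolute value below \<open>m\<close> is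
  0.\<close>

lemma int_mod_eq_imp_eq:
  fixes a b m :: int
  assumes "a mod m = b mod m" and "\<bar>a - b\<bar> < m"
  shows "a = b"
  using assms dvd_imp_le_int[of "a - b" m] by (auto simp: mod_eq_dvd_iff)

text \<open>Equal invariants mean that \<open>y\<close> is a translate of \<open>x\<close> modulo
  \<open>q\<close>. A common entry makes the translation trivial modulo \<open>q\<close>, and since
  all entries lie below \<open>q\<close>, congruent entries are equal.\<close>

lemma tail_differences_eq_imp_eq:
  assumes x: "x \<in> seqs q n" and y: "y \<in> seqs q n"
    and eq: "tail_differences q x = tail_differences q y"
    and ag: "agreement x y \<noteq> {}"
  shows "x = y"
proof -
  from ag obtain i where i: "i < length x" "i < length y" "x ! i = y ! i"
    by (auto simp: agreement_def)
  then obtain h t k u where xy: "x = h # t" "y = k # u"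
    by (cases x; cases y) auto
  have len: "length t = length u"
    using x y xy by (auto simp: seqs_def)
  have hk: "h < q" "k < q"
    using x y xy by (auto simp: seqs_def)
  have bound: "t ! j < q \<and> u ! j < q" if "j < length t" for j
  proof -
    have "set t \<subseteq> {0..<q}" "set u \<subseteq> {0..<q}"
      using x y xy by (auto simp: seqs_def)
    moreover have "t ! j \<in> set t" "u ! j \<in> set u"
      using that len by auto
    ultimately show ?thesis
      by (meson atLeastLessThan_iff subsetD)
  qed
  have diff: "(int (t ! j) - int h) mod int q = (int (u ! j) - int k) mod int q"
    if "j < length t" for j
    using arg_cong[OF eq, of "\<lambda>l. l ! j"] that len
    by (simp add: tail_differences_def xy)
  have "h = k"
  proof (cases i)
    case 0
    then show ?thesis using i xy by simp
  next
    case (Suc j)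
    then have j: "j < length t" "t ! j = u ! j"
      using i xy by auto
    \<comment> \<open>With \<open>t ! j = u ! j\<close>, the two differences differ by
      \<open>k - h\<close>, whose absolute value is below \<open>q\<close>.\<close>
    show ?thesis
      using int_mod_eq_imp_eq[OF diff[OF j(1)]] j(2) hk by auto
  qed
  moreover have "t = u"
  proof (rule nth_equalityI[OF len])
    fix j assume j: "j < length t"
    show "t ! j = u ! j"
      using int_mod_eq_imp_eq[OF diff[OF j]] bound[OF j] \<open>h = k\<close> by auto
  qed
  ultimately show ?thesis
    by (simp add: xy)
qed

lemma card_1_agreeing_le:
  assumes "q \<ge> 1" and A: "A \<subseteq> seqs q n" and ag: "s_agreeing 1 A"
  shows "card A \<le> q ^ (n - 1)"
proof -
  let ?B = "{l. set l \<subseteq> {0..<int q} \<and> length l = n - 1}"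
  have "inj_on (tail_differences q) A"
  proof (rule inj_onI, rule ccontr)
    fix x y
    assume xy: "x \<in> A" "y \<in> A" "tail_differences q x = tail_differences q y" "x \<noteq> y"
    then have "1 \<le> card (agreement x y)"
      using ag by (simp add: s_agreeing_def)
    then have "agreement x y \<noteq> {}"
      by auto
    with xy A show False
      using tail_differences_eq_imp_eq by blast
  qed
  \<comment> \<open>Positivity of \<open>q\<close> puts the residues in \<open>{0..<int q}\<close>;
    dropping the head leaves length \<open>n - 1\<close>.\<close>
  moreover have "tail_differences q ` A \<subseteq> ?B"
    using A \<open>q \<ge> 1\<close> by (auto simp: tail_differences_def seqs_def)
  moreover have "finite ?B"
    by (simp add: finite_lists_length_eq)
  ultimately have "card A \<le> card ?B"
    by (rule card_inj_on_le)
  then show ?thesis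
    by (simp add: card_lists_length_eq)
qed

lemma card_Cons_seqs: "card (Cons a ` seqs q n) = q ^ n"
  by (simp add: card_image card_seqs)

text \<open>The shared head \<open>a\<close> is a common entry at position 0.\<close>

lemma s_agreeing_1_Cons: "s_agreeing 1 (Cons a ` B)"
  unfolding s_agreeing_def
proof (intro ballI impI)
  fix x y assume "x \<in> Cons a ` B" "y \<in> Cons a ` B"
  then have "0 \<in> agreement x y"
    by (auto simp: agreement_def)
  moreover have "finite (agreement x y)"
    by (simp add: agreement_def)
  ultimately have "0 < card (agreement x y)"
    by (auto simp: card_gt_0_iff)
  then show "1 \<le> card (agreement x y)"
    by simp
qed

theorem lemma17:
  fixes q n :: nat
  assumes "q \<ge> 1" and "n \<ge> 1"
  shows "N q n 1 = q ^ (n - 1)"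
  unfolding N_def
proof (rule Max_eqI[OF finite_N_candidates])
  fix c assume "c \<in> {card A | A. A \<subseteq> seqs q n \<and> s_agreeing 1 A}"
  then show "c \<le> q ^ (n - 1)"
    using card_1_agreeing_le[OF \<open>q \<ge> 1\<close>] by blast
next
  \<comment> \<open>Here \<open>q \<ge> 1\<close> makes 0 an admissible entry, and
    \<open>n \<ge> 1\<close> makes the length \<open>Suc (n - 1)\<close> equal to
    \<open>n\<close>.\<close>
  have "Cons 0 ` seqs q (n - 1) \<subseteq> seqs q n"
    using assms by (force simp: seqs_def)
  then show "q ^ (n - 1) \<in> {card A | A. A \<subseteq> seqs q n \<and> s_agreeing 1 A}"
    using s_agreeing_1_Cons card_Cons_seqs[of 0 q "n - 1"]
    by (metis (mono_tags, lifting) mem_Collect_eq)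
qed

end
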